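(* Let $(E,D)$ be a fixed pair with $E\neq0$, satisfying $D^2\neq4$, $1+2ED+4E^2\neq0$, $D+2E\neq0$, whose level set $X(D,E)$ is nonempty. Then there are exactly two conics with foci $\mathcal O(0,0)$ and $\mathcal F(0,2)$, namely the conics $\mathcal E_+$ and $\mathcal E_-$, such that all arcs of each trajectory of the Boltzmann system on the level set $X(D,E)$ are touching those two conics.
   Context: The Boltzmann system: a unit-mass particle moves in the plane with coordinates $(x_1,x_2)$ under the Kepler potential $-1/|\mathbf r|$ with centre of gravity at the origin $\mathcal O(0,0)$, on the side $x_2\ge1$ of the wall $x_2=1$, and is reflected elastically at the wall (speed preserved, angle of incidence equals angle of reflection). Let $E=|\mathbf p|^2/2-1/|\mathbf r|$ be the energy, $L$ the angular momentum, $\mathbf A=(A_1,A_2)=\mathbf p\times\mathbf L-\mathbf r/|\mathbf r|$ the Laplace–Runge–Lenz vector. $E$ and $D:=L^2-2A_2$ are integrals of the system; $X(D,E)$ is the set of real motions with given values of these integrals. Put $R=\sqrt{1+2DE+4E^2}$; one has $A_1^2+(A_2-2E)^2=R^2$. Each arc of a trajectory lies on a Kepler conic $$x_1^2+x_2^2=(D+2A_2-A_1x_1-A_2x_2)^2,$$ with foci at the origin and at $F_2=(A_1/E,A_2/E)$. An arc is said to touch a conic if the Kepler conic containing this arc is tangent to that conic (the point of tangency may lie on the part of the Kepler conic on either side of the wall). The conics $\mathcal E_\pm$ are $$\mathcal E_{\pm}:\quad \frac{x_1^2}{\left(\frac{R\pm1}{2E}\right)^2-1}+\frac{(x_2-1)^2}{\left(\frac{R\pm1}{2E}\right)^2}=1.$$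 *)

theory Defs
  imports "HOL-Analysis.Analysis"
begin

definition energy :: "real^2 \<Rightarrow> real^2 \<Rightarrow> real" where
  "energy r p = (norm p)\<^sup>2 / 2 - 1 / norm r"

definition angular_momentum :: "real^2 \<Rightarrow> real^2 \<Rightarrow> real" where
  "angular_momentum r p = r$1 * p$2 - r$2 * p$1"

text \<open>The planar part of the vector p x L - r/|r|, where L points along the third axis.\<close>

definition LRL :: "real^2 \<Rightarrow> real^2 \<Rightarrow> real^2" where
  "LRL r p = vector [p$2 * angular_momentum r p - r$1 / norm r,
                     - (p$1 * angular_momentum r p) - r$2 / norm r]"

definition D_integral :: "real^2 \<Rightarrow> real^2 \<Rightarrow> real" where
  "D_integral r p = (angular_momentum r p)\<^sup>2 - 2 * LRL r p $ 2"

definition momentum :: "(real \<Rightarrow> real^2) \<Rightarrow> real \<Rightarrow> real^2" where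
  "momentum q t = vector_derivative q (at t)"

text \<open>
  A motion is defined for all times. Above the wall it solves Newton's equation for the
  Kepler potential. The impacts with the wall are isolated, and at each of them the one-sided
  limits of the momentum are related by the elastic reflection law; no value of the momentum
  is prescribed at the instant of impact itself.
\<close>

definition boltzmann_motion :: "(real \<Rightarrow> real^2) \<Rightarrow> bool" where
  "boltzmann_motion q \<longleftrightarrow>
     continuous_on UNIV q \<and>
     (\<forall>t. 1 \<le> q t $ 2) \<and>
     (\<forall>t. 1 < q t $ 2 \<longrightarrow>
        q differentiable (at t) \<and>
        (momentum q has_vector_derivative - (1 / norm (q t) ^ 3) *\<^sub>R q t) (at t)) \<and>
     (\<forall>t. q t $ 2 = 1 \<longrightarrow>
        (\<forall>\<^sub>F s in at t. 1 < q s $ 2) \<and>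
        (\<exists>v. (momentum q \<longlongrightarrow> v) (at_left t) \<and>
             (momentum q \<longlongrightarrow> vector [v$1, - (v$2)]) (at_right t)))"

definition level_set :: "real \<Rightarrow> real \<Rightarrow> (real \<Rightarrow> real^2) set" where
  "level_set D E = {q. boltzmann_motion q \<and>
     (\<forall>t. 1 < q t $ 2 \<longrightarrow>
        energy (q t) (momentum q t) = E \<and> D_integral (q t) (momentum q t) = D)}"

text \<open>
  An arc is given by its time interval: a maximal interval between impacts, unbounded on a
  side on which there is no further impact.
\<close>

definition arcs :: "(real \<Rightarrow> real^2) \<Rightarrow> real set set" where
  "arcs q = components {t. 1 < q t $ 2}"

text \<open>
  The equation of a conic is a symmetric matrix, understood as a quadratic form in the
  homogeneous coordinates (x1 : x2 : x3), the line at infinity being x3 = 0.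
\<close>

definition conic_points :: "real^3^3 \<Rightarrow> (real^2) set" where
  "conic_points M = {x. let h = vector [x$1, x$2, 1] in h \<bullet> (M *v h) = 0}"

definition conic_equation :: "real^3^3 \<Rightarrow> (real^2) set \<Rightarrow> bool" where
  "conic_equation M C \<longleftrightarrow> transpose M = M \<and> conic_points M = C"

text \<open>
  Tangency in the real projective plane: at some common point, possibly at infinity, the
  intersection multiplicity is at least two. In terms of equations, the gradients at this
  point are linearly dependent; if both are nonzero, the tangent lines coincide. Points at
  infinity are needed for positive energy, where the two conics may be hyperbolas that touch
  by having a common asymptote. If one conic is a double line (the Kepler conic of a radial
  arc), each common point has multiplicity at least two.
\<close>

definition tangent_conics :: "real^3^3 \<Rightarrow> real^3^3 \<Rightarrow> bool" where
  "tangent_conics M N \<longleftrightarrow>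
     (\<exists>h. h \<noteq> 0 \<and> h \<bullet> (M *v h) = 0 \<and> h \<bullet> (N *v h) = 0 \<and>
        (\<exists>a b. (a \<noteq> 0 \<or> b \<noteq> 0) \<and> a *\<^sub>R (M *v h) + b *\<^sub>R (N *v h) = 0))"

definition kepler_conic :: "real^2 \<Rightarrow> real^2 \<Rightarrow> real^3^3" where
  "kepler_conic r p =
     (let A = LRL r p; k = D_integral r p + 2 * A$2
      in vector [vector [1 - (A$1)\<^sup>2, - (A$1 * A$2), k * A$1],
                 vector [- (A$1 * A$2), 1 - (A$2)\<^sup>2, k * A$2],
                 vector [k * A$1, k * A$2, - (k\<^sup>2)]])"

lemma conic_points_kepler_conic:
  "conic_points (kepler_conic r p) =
     {x. (x$1)\<^sup>2 + (x$2)\<^sup>2 =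
           (D_integral r p + 2 * LRL r p $ 2 - LRL r p $ 1 * x$1 - LRL r p $ 2 * x$2)\<^sup>2}"
  unfolding conic_points_def kepler_conic_def Let_def
  by (auto simp: inner_vec_def matrix_vector_mult_def sum_3 power2_eq_square algebra_simps)

text \<open>
  All states of an arc have the same Kepler conic, D and the Laplace-Runge-Lenz vector being
  constant along it.
\<close>

definition arc_touches :: "(real \<Rightarrow> real^2) \<Rightarrow> real set \<Rightarrow> (real^2) set \<Rightarrow> bool" where
  "arc_touches q I C \<longleftrightarrow>
     (\<exists>N. conic_equation N C \<and>
        (\<forall>t\<in>I. tangent_conics (kepler_conic (q t) (momentum q t)) N))"

text \<open>
  Ellipses and hyperbolas with two distinct given foci; degenerate members of the confocal
  family (the segment, the rays, and the perpendicular bisector) are not conics.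
\<close>

definition conic_with_foci :: "real^2 \<Rightarrow> real^2 \<Rightarrow> (real^2) set \<Rightarrow> bool" where
  "conic_with_foci F1 F2 C \<longleftrightarrow>
     (\<exists>a. dist F1 F2 < 2 * a \<and> C = {x. dist x F1 + dist x F2 = 2 * a}) \<or>
     (\<exists>a. 0 < a \<and> 2 * a < dist F1 F2 \<and> C = {x. \<bar>dist x F1 - dist x F2\<bar> = 2 * a})"

definition R_const :: "real \<Rightarrow> real \<Rightarrow> real" where
  "R_const D E = sqrt (1 + 2 * D * E + 4 * E\<^sup>2)"

definition E_plus :: "real \<Rightarrow> real \<Rightarrow> (real^2) set" where
  "E_plus D E =
     {x. (x$1)\<^sup>2 / (((R_const D E + 1) / (2 * E))\<^sup>2 - 1)
         + (x$2 - 1)\<^sup>2 / ((R_const D E + 1) / (2 * E))\<^sup>2 = 1}"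

definition E_minus :: "real \<Rightarrow> real \<Rightarrow> (real^2) set" where
  "E_minus D E =
     {x. (x$1)\<^sup>2 / (((R_const D E - 1) / (2 * E))\<^sup>2 - 1)
         + (x$2 - 1)\<^sup>2 / ((R_const D E - 1) / (2 * E))\<^sup>2 = 1}"

end

theory Submission
  imports Defs
begin

text \<open>
  A conic with a focus at the origin has an equation |x|^2 = (linear polynomial)^2; in homogeneous
  coordinates it is h1^2 + h2^2 = (l . h)^2 for a covector l determined up to sign. Both the Kepler
  conics and the conics with foci (0,0) and (0,2) have this form. For two such conics, with
  covectors l and m, the difference of the equations is (l . h)^2 - (m . h)^2, so their common
  points lie on the two lines l . h = m . h and l . h = - m . h, and the conics touch exactly when
  one of these lines is tangent to them. A line is tangent to the cone h1^2 + h2^2 = z^2 when the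
  coefficients of the line satisfy the same type of equation, which gives the polynomial criterion
  in \<open>tangent_focal_conics_if\<close> and \<open>tangent_focal_conics_imp\<close>.

  For a Kepler conic with energy E, integral D and angular momentum L, and the confocal conic with
  semi-axis a along the line of the foci, the criterion becomes (\<open>touching_polynomial\<close>)
  L^2 (a^2 - 1) (2 E a^2 + 2 a - 2 E - D) = 0, where the sign of a records which of the two lines is
  meant. The last factor no longer involves the individual arc. It is the condition
  (2 E a + 1)^2 = R^2, whose roots are (R - 1)/(2E) and -(R + 1)/(2E): up to sign, the
  semi-axes of the two conics of the theorem. The conditions on D and E exclude the degenerate values a = 0 and
  a^2 = 1 and the coincidence R = 0.

  Conversely, a confocal conic touched by all arcs must have one of these semi-axes, provided that
  some arc has L \<noteq> 0, since radial arcs touch everything. Such an arc always exists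
  (\<open>nonradial_state_exists\<close>): the height is strictly concave between impacts, so some impact
  occurs, and a reflection at a wall point off the axis cannot turn a radial arc into a radial
  arc. Finally, touching is expressed through an equation of the conic, so one has to know that a
  real central conic determines its equation up to a factor
  (\<open>central_conic_equation_unique\<close>).
\<close>

section \<open>Tangency of conics with a common focus\<close>

text \<open>The conic h1^2 + h2^2 = (l . h)^2, with focus at the origin and directrix l . h = 0.\<close>

definition focal_conic :: "real^3 \<Rightarrow> real^3^3" where
  "focal_conic l =
     vector [vector [1 - (l$1)\<^sup>2, - (l$1 * l$2), - (l$1 * l$3)],
             vector [- (l$1 * l$2), 1 - (l$2)\<^sup>2, - (l$2 * l$3)],
             vector [- (l$1 * l$3), - (l$2 * l$3), - ((l$3)\<^sup>2)]]"

lemma focal_conic_mult: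
  "(focal_conic l *v h) $ 1 = h$1 - (l \<bullet> h) * l$1"
  "(focal_conic l *v h) $ 2 = h$2 - (l \<bullet> h) * l$2"
  "(focal_conic l *v h) $ 3 = - (l \<bullet> h) * l$3"
  by (simp_all add: focal_conic_def matrix_vector_mult_def sum_3 inner_vec_def
      power2_eq_square algebra_simps)

lemma focal_conic_form:
  "h \<bullet> (focal_conic l *v h) = (h$1)\<^sup>2 + (h$2)\<^sup>2 - (l \<bullet> h)\<^sup>2"
proof -
  have "h \<bullet> (focal_conic l *v h) =
      h$1 * (h$1 - (l \<bullet> h) * l$1) + h$2 * (h$2 - (l \<bullet> h) * l$2) + h$3 * (- (l \<bullet> h) * l$3)"
    by (simp only: inner_vec_def sum_3 focal_conic_mult inner_real_def)
  also have "\<dots> = (h$1)\<^sup>2 + (h$2)\<^sup>2 - (l \<bullet> h) * (l$1 * h$1 + l$2 * h$2 + l$3 * h$3)"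
    by (simp add: power2_eq_square algebra_simps)
  also have "l$1 * h$1 + l$2 * h$2 + l$3 * h$3 = l \<bullet> h"
    by (simp add: inner_vec_def sum_3)
  finally show ?thesis
    by (simp add: power2_eq_square)
qed

lemma focal_conic_uminus: "focal_conic (- l) = focal_conic l"
  by (simp add: focal_conic_def)

lemma transpose_focal_conic: "transpose (focal_conic l) = focal_conic l"
  by (simp add: vec_eq_iff forall_3 transpose_def focal_conic_def)

text \<open>
  The hypothesis says that the line l . h = m . h is tangent. If l3 is nonzero, (h1, h2, z) with
  z = l . h are coordinates in which the conic is the cone h1^2 + h2^2 = z^2. In them
  l3 (l - m) . h becomes g1 h1 + g2 h2 + w z, and the line touches the cone along the generator (g1, g2, -w) when
  g1^2 + g2^2 = w^2.
\<close>

lemma tangent_focal_conics_if: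
  assumes l3: "l$3 \<noteq> 0"
    and touch: "(l$3 * m$1 - m$3 * l$1)\<^sup>2 + (l$3 * m$2 - m$3 * l$2)\<^sup>2 = (l$3 - m$3)\<^sup>2"
  shows "tangent_conics (focal_conic l) (focal_conic m)"
proof (cases "l$3 = m$3")
  case True
  \<comment> \<open>Then l = m, and a conic touches itself at each of its points.\<close>
  have "l = m"
    using touch l3 True by (simp add: vec_eq_iff forall_3 sum_power2_eq_zero_iff)
  define h :: "real^3" where "h = vector [1, 0, (1 - l$1) / l$3]"
  have "l \<bullet> h = 1"
    using l3 by (simp add: h_def inner_vec_def sum_3)
  then have "h \<bullet> (focal_conic l *v h) = 0"
    by (simp add: focal_conic_form h_def)
  moreover have "h \<noteq> 0"
    by (simp add: h_def vec_eq_iff forall_3)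
  moreover have "1 *\<^sub>R (focal_conic l *v h) + (- 1) *\<^sub>R (focal_conic l *v h) = 0"
    by simp
  ultimately show ?thesis
    unfolding tangent_conics_def \<open>l = m\<close>[symmetric]
    by (metis zero_neq_one)
next
  case False
  define w where "w = l$3 - m$3"
  define g1 where "g1 = m$3 * l$1 - l$3 * m$1"
  define g2 where "g2 = m$3 * l$2 - l$3 * m$2"
  have g: "g1\<^sup>2 + g2\<^sup>2 = w\<^sup>2" and "w \<noteq> 0"
    using touch False by (simp_all add: g1_def g2_def w_def power2_commute)
  define h :: "real^3" where
    "h = vector [g1, g2, (- w - l$1 * g1 - l$2 * g2) / l$3]"
  have h: "h$1 = g1" "h$2 = g2" "l$3 * h$3 = - w - l$1 * g1 - l$2 * g2"
    using l3 by (simp_all add: h_def)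
  have lh: "l \<bullet> h = - w"
    by (simp add: inner_vec_def sum_3 h)
  have "l$3 * (l \<bullet> h - m \<bullet> h)
      = l$3 * (l$1 - m$1) * g1 + l$3 * (l$2 - m$2) * g2 + w * (l$3 * h$3)"
    by (simp add: inner_vec_def sum_3 h(1,2) w_def algebra_simps)
  also have "\<dots> = (l$3 * (l$1 - m$1) - w * l$1) * g1 + (l$3 * (l$2 - m$2) - w * l$2) * g2 - w\<^sup>2"
    unfolding h(3) by (simp add: power2_eq_square algebra_simps)
  also have "\<dots> = g1\<^sup>2 + g2\<^sup>2 - w\<^sup>2"
    by (simp add: g1_def g2_def w_def power2_eq_square algebra_simps)
  finally have mh: "m \<bullet> h = - w"
    using g l3 lh by simp
  have nz: "h \<noteq> 0"
    using g \<open>w \<noteq> 0\<close> h by auto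
  have pts: "h \<bullet> (focal_conic l *v h) = 0" "h \<bullet> (focal_conic m *v h) = 0"
    by (simp_all add: focal_conic_form lh mh h g)
  have dep: "m$3 *\<^sub>R (focal_conic l *v h) + (- l$3) *\<^sub>R (focal_conic m *v h) = 0"
    by (simp add: vec_eq_iff forall_3 focal_conic_mult lh mh h)
       (simp add: g1_def g2_def w_def algebra_simps)
  show ?thesis
    unfolding tangent_conics_def using nz pts dep l3 by (metis neg_equal_0_iff_equal)
qed

text \<open>
  At a point of tangency l . h = \<sigma> (m . h) for some sign \<sigma>, and this number is nonzero because the
  common focus lies on neither conic. The third component of the linear relation between the
  gradients fixes the ratio of the coefficients; the other two then show that (h1, h2) is
  proportional to l3 (m1, m2) - m3 (l1, l2), and taking norms gives the criterion. Changing the sign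
  of m leaves the conic unchanged, so \<sigma> cannot be prescribed.
\<close>

lemma tangent_focal_conics_imp:
  assumes l3: "l$3 \<noteq> 0" and m3: "m$3 \<noteq> 0"
    and tangent: "tangent_conics (focal_conic l) (focal_conic m)"
  shows "\<exists>\<sigma>\<in>{1, - 1}. (l$3 * m$1 - m$3 * l$1)\<^sup>2 + (l$3 * m$2 - m$3 * l$2)\<^sup>2
           = (l$3 - \<sigma> * m$3)\<^sup>2"
proof -
  obtain h a b where "h \<noteq> 0"
    and pl: "(h$1)\<^sup>2 + (h$2)\<^sup>2 = (l \<bullet> h)\<^sup>2" and pm: "(h$1)\<^sup>2 + (h$2)\<^sup>2 = (m \<bullet> h)\<^sup>2"
    and ab: "a \<noteq> 0 \<or> b \<noteq> 0"
    and dep: "a *\<^sub>R (focal_conic l *v h) + b *\<^sub>R (focal_conic m *v h) = 0"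
    using tangent unfolding tangent_conics_def focal_conic_form right_minus_eq by blast
  define z where "z = l \<bullet> h"
  have "z \<noteq> 0"
  proof
    assume "z = 0"
    then have "h$1 = 0" "h$2 = 0"
      using pl by (simp_all add: z_def sum_power2_eq_zero_iff)
    moreover have "h$3 = 0"
      using \<open>z = 0\<close> l3 calculation by (simp add: z_def inner_vec_def sum_3)
    ultimately show False
      using \<open>h \<noteq> 0\<close> by (simp add: vec_eq_iff forall_3)
  qed
  have "(m \<bullet> h)\<^sup>2 = z\<^sup>2"
    using pl pm by (simp add: z_def)
  then obtain \<sigma> :: real where \<sigma>: "\<sigma> \<in> {1, - 1}" "m \<bullet> h = \<sigma> * z"
    unfolding power2_eq_iff by force
  have d: "a * (h$i - z * l$i) + b * (h$i - \<sigma> * z * m$i) = 0" if "i = 1 \<or> i = 2" for i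
    using arg_cong[OF dep, of "\<lambda>v. v $ i"] that
    by (auto simp: focal_conic_mult \<sigma> z_def[symmetric])
  have "z * (a * l$3 + b * \<sigma> * m$3) = 0"
    using arg_cong[OF dep, of "\<lambda>v. v $ 3"]
    by (simp add: focal_conic_mult \<sigma> z_def[symmetric] algebra_simps)
  then have d3: "a * l$3 = - (b * \<sigma> * m$3)"
    using \<open>z \<noteq> 0\<close> by simp
  have "b \<noteq> 0"
    using ab d3 l3 by auto
  have eq: "(l$3 - \<sigma> * m$3) * h$i = \<sigma> * z * (l$3 * m$i - m$3 * l$i)" if "i = 1 \<or> i = 2" for i
  proof -
    have "0 = (a * l$3) * (h$i - z * l$i) + l$3 * b * (h$i - \<sigma> * z * m$i)"
      using d[OF that] by (metis (no_types, lifting) distrib_left mult.assoc mult.commute mult_zero_right)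
    also have "\<dots> = b * ((l$3 - \<sigma> * m$3) * h$i - \<sigma> * z * l$3 * m$i + \<sigma> * m$3 * z * l$i)"
      unfolding d3 by (simp add: algebra_simps)
    finally have "(l$3 - \<sigma> * m$3) * h$i - \<sigma> * z * l$3 * m$i + \<sigma> * m$3 * z * l$i = 0"
      using \<open>b \<noteq> 0\<close> by simp
    then show ?thesis
      by (simp add: algebra_simps)
  qed
  have "z\<^sup>2 * (l$3 - \<sigma> * m$3)\<^sup>2 = ((l$3 - \<sigma> * m$3) * h$1)\<^sup>2 + ((l$3 - \<sigma> * m$3) * h$2)\<^sup>2"
    unfolding power_mult_distrib distrib_left[symmetric] pl z_def by (rule mult.commute)
  also have "\<dots> = z\<^sup>2 * ((l$3 * m$1 - m$3 * l$1)\<^sup>2 + (l$3 * m$2 - m$3 * l$2)\<^sup>2)"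
    using eq[of 1] eq[of 2] \<sigma> by (auto simp: power_mult_distrib distrib_left)
  finally show ?thesis
    using \<open>z \<noteq> 0\<close> \<sigma>(1) by (intro bexI[of _ \<sigma>]) auto
qed

text \<open>
  With l3 = 0 and (l1, l2) a unit vector, the conic is the line through the origin in the direction
  (l1, l2), counted twice. Its gradient vanishes on the line, so any common point will do, and a
  line through a focus of a conic always meets it in the real projective plane.
\<close>

lemma tangent_double_line:
  assumes "l$3 = 0" "(l$1)\<^sup>2 + (l$2)\<^sup>2 = 1" "m$3 \<noteq> 0"
  shows "tangent_conics (focal_conic l) (focal_conic m)"
proof -
  define h :: "real^3" where
    "h = vector [l$1, l$2, (1 - m$1 * l$1 - m$2 * l$2) / m$3]"
  have lh: "l \<bullet> h = 1"
    using assms by (simp add: h_def inner_vec_def sum_3 power2_eq_square)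
  have mh: "m \<bullet> h = 1"
    using assms by (simp add: h_def inner_vec_def sum_3)
  have "focal_conic l *v h = 0"
    using assms(1) by (simp add: vec_eq_iff forall_3 focal_conic_mult lh) (simp add: h_def)
  moreover have "h \<bullet> (focal_conic m *v h) = 0"
    using assms(2) by (simp add: focal_conic_form mh) (simp add: h_def)
  moreover have "h \<noteq> 0"
    using lh by auto
  ultimately show ?thesis
    unfolding tangent_conics_def
    by (intro exI[of _ h] conjI exI[of _ "1::real"] exI[of _ "0::real"]) simp_all
qed

section \<open>The conics with foci (0,0) and (0,2)\<close>

text \<open>
  If u and v are the distances of x from the foci (0,0) and (0,2), then u^2 - v^2 = 4 (x2 - 1); together
  with u + v = 2 a or u - v = 2 a this gives u = a + (x2 - 1) / a, the linear polynomial encoded here.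
  Negative a are allowed: they give the opposite covector, hence the same conic.
\<close>

definition confocal_covector :: "real \<Rightarrow> real^3" where
  "confocal_covector a = vector [0, 1 / a, a - 1 / a]"

definition central_conic :: "real \<Rightarrow> (real^2) set" where
  "central_conic a = {x. (x$1)\<^sup>2 / (a\<^sup>2 - 1) + (x$2 - 1)\<^sup>2 / a\<^sup>2 = 1}"

lemma confocal_covector_uminus: "confocal_covector (- a) = - confocal_covector a"
  by (simp add: vec_eq_iff forall_3 confocal_covector_def)

lemma central_conic_uminus: "central_conic (- a) = central_conic a"
  by (simp add: central_conic_def)

lemma central_conic_iff:
  assumes "a \<noteq> 0" "a\<^sup>2 \<noteq> 1"
  shows "x \<in> central_conic a \<longleftrightarrow> a\<^sup>2 * (x$1)\<^sup>2 + (a\<^sup>2 - 1) * (x$2 - 1)\<^sup>2 = a\<^sup>2 * (a\<^sup>2 - 1)"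
proof -
  have "x \<in> central_conic a \<longleftrightarrow>
      a\<^sup>2 * (a\<^sup>2 - 1) * ((x$1)\<^sup>2 / (a\<^sup>2 - 1) + (x$2 - 1)\<^sup>2 / a\<^sup>2) = a\<^sup>2 * (a\<^sup>2 - 1) * 1"
    using assms unfolding central_conic_def by (subst mult_cancel_left) simp
  also have "a\<^sup>2 * (a\<^sup>2 - 1) * ((x$1)\<^sup>2 / (a\<^sup>2 - 1) + (x$2 - 1)\<^sup>2 / a\<^sup>2)
      = a\<^sup>2 * (x$1)\<^sup>2 + (a\<^sup>2 - 1) * (x$2 - 1)\<^sup>2"
    using assms by (simp add: distrib_left)
  finally show ?thesis
    by simp
qed

lemma conic_equation_central_conic:
  assumes "a \<noteq> 0" "a\<^sup>2 \<noteq> 1"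
  shows "conic_equation (focal_conic (confocal_covector a)) (central_conic a)"
proof -
  have "x \<in> conic_points (focal_conic (confocal_covector a)) \<longleftrightarrow> x \<in> central_conic a" for x
  proof -
    have "x \<in> conic_points (focal_conic (confocal_covector a)) \<longleftrightarrow>
        (x$1)\<^sup>2 + (x$2)\<^sup>2 - (x$2 / a + (a - 1 / a))\<^sup>2 = 0"
    proof -
      have "confocal_covector a \<bullet> vector [x$1, x$2, 1] = x$2 / a + (a - 1 / a)"
        by (simp add: confocal_covector_def inner_vec_def sum_3)
      then show ?thesis
        by (simp add: conic_points_def Let_def focal_conic_form)
    qed
    also have "\<dots> \<longleftrightarrow> a\<^sup>2 * ((x$1)\<^sup>2 + (x$2)\<^sup>2 - (x$2 / a + (a - 1 / a))\<^sup>2) = 0"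
      using assms by simp
    also have "a\<^sup>2 * ((x$1)\<^sup>2 + (x$2)\<^sup>2 - (x$2 / a + (a - 1 / a))\<^sup>2)
        = a\<^sup>2 * (x$1)\<^sup>2 + (a\<^sup>2 - 1) * (x$2 - 1)\<^sup>2 - a\<^sup>2 * (a\<^sup>2 - 1)"
      using assms(1) by (simp add: field_simps power2_eq_square)
    finally show ?thesis
      using assms by (simp add: central_conic_iff)
  qed
  then show ?thesis
    by (auto simp: conic_equation_def transpose_focal_conic)
qed

text \<open>
  The product ((u + v)^2 - 4 a^2) ((u - v)^2 - 4 a^2) is a polynomial in u^2 and v^2 and vanishes exactly
  on the central conic. The triangle inequality |u - v| \<le> 2 \<le> u + v then decides by the sign of
  a - 1 which of the two factors can vanish.
\<close>

lemma conic_with_foci_iff_central: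
  "conic_with_foci 0 (vector [0, 2]) C \<longleftrightarrow> (\<exists>a>0. a \<noteq> 1 \<and> C = central_conic a)"
proof -
  define F :: "real^2" where "F = vector [0, 2]"
  have dF: "dist 0 F = 2"
    by (simp add: F_def norm_vec_def L2_set_def sum_2)
  have nsq: "(norm x)\<^sup>2 = (x$1)\<^sup>2 + (x$2)\<^sup>2" for x :: "real^2"
    by (simp add: norm_vec_def L2_set_def sum_2)
  have key: "x \<in> central_conic a \<longleftrightarrow> dist x 0 + dist x F = 2 * a \<or> \<bar>dist x 0 - dist x F\<bar> = 2 * a"
    if "a > 0" "a \<noteq> 1" for a x
  proof -
    define u v where "u = dist x 0" and "v = dist x F"
    have u2: "u\<^sup>2 = (x$1)\<^sup>2 + (x$2)\<^sup>2"
      by (simp add: u_def nsq)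
    have v2: "v\<^sup>2 = (x$1)\<^sup>2 + (x$2 - 2)\<^sup>2"
      by (simp add: v_def dist_norm nsq F_def)
    have uv: "u \<ge> 0" "v \<ge> 0"
      by (simp_all add: u_def v_def)
    have "u + v = 2 * a \<or> \<bar>u - v\<bar> = 2 * a \<longleftrightarrow> (u + v)\<^sup>2 = (2 * a)\<^sup>2 \<or> (u - v)\<^sup>2 = (2 * a)\<^sup>2"
      using uv \<open>a > 0\<close> unfolding power2_eq_iff by arith
    also have "\<dots> \<longleftrightarrow> ((u + v)\<^sup>2 - (2 * a)\<^sup>2) * ((u - v)\<^sup>2 - (2 * a)\<^sup>2) = 0"
      by simp
    also have "((u + v)\<^sup>2 - (2 * a)\<^sup>2) * ((u - v)\<^sup>2 - (2 * a)\<^sup>2)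
        = (u\<^sup>2 - v\<^sup>2)\<^sup>2 - 8 * a\<^sup>2 * (u\<^sup>2 + v\<^sup>2) + 16 * a\<^sup>2 * a\<^sup>2"
      by (simp add: power2_eq_square algebra_simps)
    also have "\<dots> = - 16 * (a\<^sup>2 * (x$1)\<^sup>2 + (a\<^sup>2 - 1) * (x$2 - 1)\<^sup>2 - a\<^sup>2 * (a\<^sup>2 - 1))"
      unfolding u2 v2 by (simp add: power2_eq_square algebra_simps)
    finally have "u + v = 2 * a \<or> \<bar>u - v\<bar> = 2 * a \<longleftrightarrow>
        a\<^sup>2 * (x$1)\<^sup>2 + (a\<^sup>2 - 1) * (x$2 - 1)\<^sup>2 = a\<^sup>2 * (a\<^sup>2 - 1)"
      by (simp only: mult_eq_0_iff right_minus_eq) simp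
    then show ?thesis
      using that central_conic_iff[of a x] by (simp only: u_def v_def power2_eq_1_iff) auto
  qed
  have tri: "\<bar>dist x 0 - dist x F\<bar> \<le> 2" "2 \<le> dist x 0 + dist x F" for x
    using dist_triangle2[of 0 F x] dist_triangle3[of 0 F x] dist_triangle[of x 0 F]
      dist_triangle[of x F 0] dF by (auto simp: dist_commute)
  have ell: "central_conic a = {x. dist x 0 + dist x F = 2 * a}" if "a > 1" for a
  proof -
    have "\<bar>dist x 0 - dist x F\<bar> \<noteq> 2 * a" for x
      using tri(1)[of x] that by linarith
    then show ?thesis
      using key[of a] that by auto
  qed
  have hyp: "central_conic a = {x. \<bar>dist x 0 - dist x F\<bar> = 2 * a}" if "a > 0" "a < 1" for a
  proof -
    have "dist x 0 + dist x F \<noteq> 2 * a" for x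
      using tri(2)[of x] that by linarith
    then show ?thesis
      using key[of a] that by auto
  qed
  show ?thesis
    unfolding conic_with_foci_def F_def[symmetric] dF
  proof
    assume "(\<exists>a. 2 < 2 * a \<and> C = {x. dist x 0 + dist x F = 2 * a}) \<or>
      (\<exists>a>0. 2 * a < 2 \<and> C = {x. \<bar>dist x 0 - dist x F\<bar> = 2 * a})"
    then show "\<exists>a>0. a \<noteq> 1 \<and> C = central_conic a"
    proof (elim disjE exE conjE)
      fix a :: real
      assume "2 < 2 * a" "C = {x. dist x 0 + dist x F = 2 * a}"
      then show ?thesis
        using ell[of a] by (intro exI[of _ a]) auto
    next
      fix a :: real
      assume "0 < a" "2 * a < 2" "C = {x. \<bar>dist x 0 - dist x F\<bar> = 2 * a}"
      then show ?thesis
        using hyp[of a] by (intro exI[of _ a]) auto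
    qed
  next
    assume "\<exists>a>0. a \<noteq> 1 \<and> C = central_conic a"
    then obtain a where a: "a > 0" "a \<noteq> 1" "C = central_conic a"
      by blast
    then consider "a > 1" | "a < 1"
      by linarith
    then show "(\<exists>a. 2 < 2 * a \<and> C = {x. dist x 0 + dist x F = 2 * a}) \<or>
      (\<exists>a>0. 2 * a < 2 \<and> C = {x. \<bar>dist x 0 - dist x F\<bar> = 2 * a})"
    proof cases
      case 1
      then show ?thesis using ell[of a] a by (intro disjI1 exI[of _ a]) auto
    next
      case 2
      then show ?thesis using hyp[of a] a by (intro disjI2 exI[of _ a]) auto
    qed
  qed
qed

text \<open>The vertex (0, 1 + a) on the axis of the foci reveals the semi-axis.\<close>

lemma central_conic_cong_square:
  assumes "a \<noteq> 0" "b \<noteq> 0" "central_conic a = central_conic b"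
  shows "a\<^sup>2 = b\<^sup>2"
proof -
  have "vector [0, 1 + a] \<in> central_conic a"
    using assms(1) by (simp add: central_conic_def)
  then have "vector [0, 1 + a] \<in> central_conic b"
    by (simp only: assms(3))
  then show ?thesis
    using assms(2) by (simp add: central_conic_def)
qed

text \<open>
  The reflections of one point off the axes kill the coefficients of the monomials that are odd
  in a coordinate centred at (0, 1), and a vertex together with that point fixes the ratio of the remaining three.
\<close>

lemma central_conic_equation_unique:
  assumes a: "a \<noteq> 0" "a\<^sup>2 \<noteq> 1"
    and N: "conic_equation N (central_conic a)"
  shows "\<exists>c. c \<noteq> 0 \<and> N = c *\<^sub>R focal_conic (confocal_covector a)"
proof -
  \<comment> \<open>Q is the given equation in coordinates centred at (0, 1).\<close>
  define Q where "Q x y = N$1$1 * x\<^sup>2 + 2 * N$1$2 * x * y + N$2$2 * y\<^sup>2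
      + 2 * (N$1$3 + N$1$2) * x + 2 * (N$2$3 + N$2$2) * y
      + (N$3$3 + 2 * N$2$3 + N$2$2)" for x y
  have sym: "N$2$1 = N$1$2" "N$3$1 = N$1$3" "N$3$2 = N$2$3"
    using N unfolding conic_equation_def transpose_def vec_eq_iff by auto
  have "conic_points N = central_conic a"
    using N by (simp add: conic_equation_def)
  moreover have "vector [x, 1 + y] \<in> conic_points N \<longleftrightarrow> Q x y = 0" for x y
    by (simp add: conic_points_def Let_def Q_def inner_vec_def matrix_vector_mult_def sum_3 sym
        power2_eq_square algebra_simps)
  ultimately have Q: "Q x y = 0 \<longleftrightarrow> a\<^sup>2 * x\<^sup>2 + (a\<^sup>2 - 1) * y\<^sup>2 = a\<^sup>2 * (a\<^sup>2 - 1)" for x y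
    using central_conic_iff[OF a, of "vector [x, 1 + y]"] by simp
  \<comment> \<open>Pythagorean triples give a point with square roots only of \<bar>a^2 - 1\<bar>: on the ellipse
    (3/5)^2 + (4/5)^2 = 1, on the hyperbola (5/4)^2 - (3/4)^2 = 1.\<close>
  obtain X Y where XY: "X \<noteq> 0" "Y \<noteq> 0" "a\<^sup>2 * X\<^sup>2 + (a\<^sup>2 - 1) * Y\<^sup>2 = a\<^sup>2 * (a\<^sup>2 - 1)"
  proof (cases "a\<^sup>2 > 1")
    case True
    show ?thesis
      by (rule that[of "3 / 5 * sqrt (a\<^sup>2 - 1)" "4 / 5 * a"])
         (use True a in \<open>auto simp: power_mult_distrib power_divide field_simps\<close>)
  next
    case False
    then have "a\<^sup>2 < 1"
      using a by simp
    show ?thesis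
      by (rule that[of "3 / 4 * sqrt (1 - a\<^sup>2)" "5 / 4 * a"])
         (use \<open>a\<^sup>2 < 1\<close> a in \<open>auto simp: power_mult_distrib power_divide field_simps\<close>)
  qed
  have "Q X Y = 0" "Q (- X) Y = 0" "Q X (- Y) = 0" "Q (- X) (- Y) = 0" "Q 0 a = 0"
    using XY(3) by (simp_all add: Q)
  moreover have "8 * (N$1$2 * X * Y) = Q X Y - Q (- X) Y - Q X (- Y) + Q (- X) (- Y)"
    "8 * ((N$1$3 + N$1$2) * X) = Q X Y - Q (- X) Y + Q X (- Y) - Q (- X) (- Y)"
    "8 * ((N$2$3 + N$2$2) * Y) = Q X Y + Q (- X) Y - Q X (- Y) - Q (- X) (- Y)"
    "4 * (N$1$1 * X\<^sup>2 + N$2$2 * Y\<^sup>2 + (N$3$3 + 2 * N$2$3 + N$2$2))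
      = Q X Y + Q (- X) Y + Q X (- Y) + Q (- X) (- Y)"
    "N$2$2 * a\<^sup>2 + 2 * (N$2$3 + N$2$2) * a + (N$3$3 + 2 * N$2$3 + N$2$2) = Q 0 a"
    by (simp_all add: Q_def algebra_simps)
  ultimately have z: "N$1$2 * X * Y = 0" "(N$1$3 + N$1$2) * X = 0" "(N$2$3 + N$2$2) * Y = 0"
    "4 * (N$1$1 * X\<^sup>2 + N$2$2 * Y\<^sup>2 + (N$3$3 + 2 * N$2$3 + N$2$2)) = 0"
    and e2: "N$2$2 * a\<^sup>2 + 2 * (N$2$3 + N$2$2) * a + (N$3$3 + 2 * N$2$3 + N$2$2) = 0"
    by simp_all
  then have e1: "N$1$1 * X\<^sup>2 + N$2$2 * Y\<^sup>2 + (N$3$3 + 2 * N$2$3 + N$2$2) = 0"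
    by simp
  have n: "N$1$2 = 0" "N$1$3 = 0" "N$2$3 = - (N$2$2)"
    using z XY by auto
  have n33: "N$3$3 = N$2$2 * (1 - a\<^sup>2)"
    using e2 by (simp add: n algebra_simps)
  have "(a\<^sup>2 - 1) * N$1$1 * X\<^sup>2 = N$2$2 * ((a\<^sup>2 - 1) * (a\<^sup>2 - Y\<^sup>2))"
  proof -
    have "N$1$1 * X\<^sup>2 = N$2$2 * (a\<^sup>2 - Y\<^sup>2)"
      using e1 by (simp add: n n33 algebra_simps)
    then show ?thesis
      by (metis mult.assoc mult.left_commute)
  qed
  also have "(a\<^sup>2 - 1) * (a\<^sup>2 - Y\<^sup>2) = a\<^sup>2 * X\<^sup>2"
    using XY(3) by (simp add: algebra_simps)
  finally have "X\<^sup>2 * ((a\<^sup>2 - 1) * N$1$1) = X\<^sup>2 * (a\<^sup>2 * N$2$2)"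
    by (simp only: mult_ac)
  then have n11: "(a\<^sup>2 - 1) * N$1$1 = a\<^sup>2 * N$2$2"
    using XY(1) by simp
  have n22: "N$2$2 = N$1$1 * (1 - 1 / a\<^sup>2)"
    using n11 a by (simp add: field_simps)
  have "N = N$1$1 *\<^sub>R focal_conic (confocal_covector a)"
    using a by (simp add: vec_eq_iff forall_3 sym n n33 focal_conic_def confocal_covector_def)
       (simp add: n22 field_simps power2_eq_square)
  moreover have "N$1$1 \<noteq> 0"
  \<comment> \<open>Otherwise N = 0, whereas the centre does not lie on the conic.\<close>
  proof
    assume "N$1$1 = 0"
    then have "Q 0 0 = 0"
      by (simp add: Q_def n n33 n22)
    then show False
      using a by (simp add: Q)
  qed
  ultimately show ?thesis
    by blast
qed

lemma tangent_conics_scaleR_right: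
  assumes "c \<noteq> 0" "tangent_conics M (c *\<^sub>R N)"
  shows "tangent_conics M N"
proof -
  obtain h a b where h: "h \<noteq> 0" "h \<bullet> (M *v h) = 0" "h \<bullet> ((c *\<^sub>R N) *v h) = 0"
    "a \<noteq> 0 \<or> b \<noteq> 0" "a *\<^sub>R (M *v h) + b *\<^sub>R ((c *\<^sub>R N) *v h) = 0"
    using assms(2) unfolding tangent_conics_def by blast
  have s: "(c *\<^sub>R N) *v h = c *\<^sub>R (N *v h)"
    by (simp add: scaleR_matrix_vector_assoc)
  have "h \<bullet> (N *v h) = 0" "a *\<^sub>R (M *v h) + (b * c) *\<^sub>R (N *v h) = 0" "a \<noteq> 0 \<or> b * c \<noteq> 0"
    using h assms(1) by (auto simp: s)
  then show ?thesis
    unfolding tangent_conics_def using h(1,2) by blast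
qed

section \<open>Kepler conics touching a confocal conic\<close>

definition kepler_covector :: "real^2 \<Rightarrow> real^2 \<Rightarrow> real^3" where
  "kepler_covector r p = vector [- LRL r p $ 1, - LRL r p $ 2, (angular_momentum r p)\<^sup>2]"

lemma kepler_conic_eq_focal: "kepler_conic r p = focal_conic (kepler_covector r p)"
  by (simp add: vec_eq_iff forall_3 kepler_conic_def focal_conic_def kepler_covector_def Let_def
      D_integral_def)

lemma LRL_square:
  assumes "r \<noteq> 0"
  shows "(LRL r p $ 1)\<^sup>2 + (LRL r p $ 2)\<^sup>2 = 1 + 2 * energy r p * (angular_momentum r p)\<^sup>2"
proof -
  define \<rho> where "\<rho> = norm r"
  have \<rho>: "\<rho> > 0" "\<rho>\<^sup>2 = (r$1)\<^sup>2 + (r$2)\<^sup>2"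
  proof -
    show "\<rho> > 0"
      using assms by (simp add: \<rho>_def)
    show "\<rho>\<^sup>2 = (r$1)\<^sup>2 + (r$2)\<^sup>2"
      by (simp add: \<rho>_def norm_vec_def L2_set_def sum_2)
  qed
  have p: "(norm p)\<^sup>2 = (p$1)\<^sup>2 + (p$2)\<^sup>2"
    by (simp add: norm_vec_def L2_set_def sum_2)
  define L where "L = angular_momentum r p"
  have "(LRL r p $ 1)\<^sup>2 + (LRL r p $ 2)\<^sup>2
      = (p$2 * L - r$1 / \<rho>)\<^sup>2 + (- (p$1 * L) - r$2 / \<rho>)\<^sup>2"
    by (simp add: LRL_def L_def \<rho>_def)
  also have "\<dots> = ((p$1)\<^sup>2 + (p$2)\<^sup>2) * L\<^sup>2 - 2 * L * (r$1 * p$2 - r$2 * p$1) / \<rho>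
      + ((r$1)\<^sup>2 + (r$2)\<^sup>2) / \<rho>\<^sup>2"
    by (simp add: power2_eq_square diff_divide_distrib add_divide_distrib algebra_simps)
  also have "\<dots> = 1 + 2 * energy r p * L\<^sup>2"
  proof -
    have "r$1 * p$2 - r$2 * p$1 = L"
      by (simp add: L_def angular_momentum_def)
    moreover have "((r$1)\<^sup>2 + (r$2)\<^sup>2) / \<rho>\<^sup>2 = 1"
      unfolding \<rho>(2)[symmetric] using \<rho>(1) by simp
    moreover have "2 * energy r p = (p$1)\<^sup>2 + (p$2)\<^sup>2 - 2 / \<rho>"
      by (simp add: energy_def p \<rho>_def)
    ultimately show ?thesis
      by (simp only:) (simp add: power2_eq_square left_diff_distrib)
  qed
  finally show ?thesis
    by (simp add: L_def)
qed

text \<open>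
  The Laplace-Runge-Lenz vector moves on a circle with centre (0, 2E); in particular the square of
  its radius, the number under the root in the constant R, is nonnegative.
\<close>

lemma LRL_circle:
  assumes "r \<noteq> 0"
  shows "(LRL r p $ 1)\<^sup>2 + (LRL r p $ 2 - 2 * energy r p)\<^sup>2
    = 1 + 2 * D_integral r p * energy r p + 4 * (energy r p)\<^sup>2"
  using LRL_square[OF assms, of p] by (simp add: D_integral_def power2_eq_square algebra_simps)

lemma confocal_third_nonzero:
  assumes "a \<noteq> 0" "a\<^sup>2 \<noteq> 1"
  shows "confocal_covector a $ 3 \<noteq> 0"
  using assms by (simp add: confocal_covector_def field_simps power2_eq_square)

text \<open>
  The tangency criterion is quadratic in the Laplace-Runge-Lenz vector A. Its square is
  |A|^2 = 1 + 2 E L^2, and A2 = (L^2 - D)/2 by the definition of D; after these substitutions A disappears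
  and only the constants of the level set and the trivial factors L^2 and a^2 - 1 remain.
\<close>

lemma touching_polynomial:
  fixes r p :: "real^2" and a :: real
  defines "l \<equiv> kepler_covector r p" and "m \<equiv> confocal_covector a"
  assumes "r \<noteq> 0" "a \<noteq> 0"
  shows "a\<^sup>2 * ((l$3 * m$1 - m$3 * l$1)\<^sup>2 + (l$3 * m$2 - m$3 * l$2)\<^sup>2 - (l$3 - m$3)\<^sup>2)
      = (angular_momentum r p)\<^sup>2 * (a\<^sup>2 - 1) *
        (2 * energy r p * a\<^sup>2 + 2 * a - 2 * energy r p - D_integral r p)"
proof -
  define A1 A2 k where "A1 = LRL r p $ 1" and "A2 = LRL r p $ 2" and "k = (angular_momentum r p)\<^sup>2"
  define b where "b = a\<^sup>2 - 1"
  have A: "A1\<^sup>2 + A2\<^sup>2 = 1 + 2 * energy r p * k"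
    using LRL_square[OF assms(3)] by (simp add: A1_def A2_def k_def)
  have D: "2 * A2 = k - D_integral r p"
    by (simp add: A2_def k_def D_integral_def)
  have "a\<^sup>2 * ((l$3 * m$1 - m$3 * l$1)\<^sup>2 + (l$3 * m$2 - m$3 * l$2)\<^sup>2 - (l$3 - m$3)\<^sup>2)
      = (a * ((a - 1 / a) * A1))\<^sup>2 + (a * (k * (1 / a) + (a - 1 / a) * A2))\<^sup>2
        - (a * (k - (a - 1 / a)))\<^sup>2"
    unfolding power_mult_distrib[of a]
    by (simp add: l_def m_def kepler_covector_def confocal_covector_def A1_def A2_def k_def
        right_diff_distrib distrib_left)
  also have "a * ((a - 1 / a) * A1) = b * A1"
    using assms(4) by (simp add: b_def field_simps power2_eq_square)
  also have "a * (k * (1 / a) + (a - 1 / a) * A2) = k + b * A2"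
    using assms(4) by (simp add: b_def field_simps power2_eq_square)
  also have "a * (k - (a - 1 / a)) = a * k - b"
    using assms(4) by (simp add: b_def field_simps power2_eq_square)
  also have "(b * A1)\<^sup>2 + (k + b * A2)\<^sup>2 - (a * k - b)\<^sup>2
      = b\<^sup>2 * (A1\<^sup>2 + A2\<^sup>2) + k * b * (2 * A2) + k\<^sup>2 - (a * k - b)\<^sup>2"
    by (simp add: power2_eq_square algebra_simps)
  also have "\<dots> = k * b * (2 * energy r p * b + 2 * a - D_integral r p)"
    unfolding A D b_def by (simp add: power2_eq_square algebra_simps)
  also have "\<dots> = k * b * (2 * energy r p * a\<^sup>2 + 2 * a - 2 * energy r p - D_integral r p)"
    by (simp add: b_def algebra_simps)
  finally show ?thesis
    by (simp add: k_def b_def)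
qed

lemma kepler_conic_touches_confocal:
  assumes "r \<noteq> 0" "a \<noteq> 0" "a\<^sup>2 \<noteq> 1"
    and root: "2 * energy r p * a\<^sup>2 + 2 * a - 2 * energy r p - D_integral r p = 0"
  shows "tangent_conics (kepler_conic r p) (focal_conic (confocal_covector a))"
proof (cases "angular_momentum r p = 0")
  case True
  then show ?thesis
    using LRL_square[OF assms(1), of p] confocal_third_nonzero[OF assms(2,3)]
    unfolding kepler_conic_eq_focal
    by (intro tangent_double_line) (simp_all add: kepler_covector_def)
next
  case False
  then have "kepler_covector r p $ 3 \<noteq> 0"
    by (simp add: kepler_covector_def)
  then show ?thesis
    using touching_polynomial[OF assms(1,2), of p] root assms(2)
    unfolding kepler_conic_eq_focal by (intro tangent_focal_conics_if) simp_all
qed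

text \<open>
  The sign \<sigma> in the tangency criterion is absorbed into a, since the covectors of a and -a are
  opposite.
\<close>

lemma confocal_touching_root:
  assumes "r \<noteq> 0" "a \<noteq> 0" "a\<^sup>2 \<noteq> 1" "angular_momentum r p \<noteq> 0"
    and tangent: "tangent_conics (kepler_conic r p) (focal_conic (confocal_covector a))"
  shows "\<exists>b\<in>{a, - a}. 2 * energy r p * b\<^sup>2 + 2 * b - 2 * energy r p - D_integral r p = 0"
proof -
  define l where "l = kepler_covector r p"
  have "l$3 \<noteq> 0"
    using assms(4) by (simp add: l_def kepler_covector_def)
  then obtain \<sigma> :: real where \<sigma>: "\<sigma> \<in> {1, - 1}"
    and eq: "(l$3 * confocal_covector a $ 1 - confocal_covector a $ 3 * l$1)\<^sup>2
        + (l$3 * confocal_covector a $ 2 - confocal_covector a $ 3 * l$2)\<^sup>2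
      = (l$3 - \<sigma> * confocal_covector a $ 3)\<^sup>2"
    using tangent_focal_conics_imp[of l "confocal_covector a"] tangent
      confocal_third_nonzero[OF assms(2,3)]
    unfolding kepler_conic_eq_focal l_def[symmetric] by metis
  define b where "b = \<sigma> * a"
  have b: "b \<in> {a, - a}" "b \<noteq> 0" "b\<^sup>2 \<noteq> 1"
    using \<sigma> assms(2,3) by (auto simp: b_def)
  define m where "m = confocal_covector b"
  have "(l$3 * m$1 - m$3 * l$1)\<^sup>2 + (l$3 * m$2 - m$3 * l$2)\<^sup>2 = (l$3 - m$3)\<^sup>2"
    using \<sigma>
  proof
    assume "\<sigma> = 1"
    then show ?thesis
      using eq by (simp add: m_def b_def)
  next
    assume "\<sigma> \<in> {- 1}"
    then have "\<sigma> = - 1" "m = - confocal_covector a"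
      by (simp_all add: m_def b_def confocal_covector_uminus)
    then show ?thesis
      using eq by (simp add: power2_eq_square algebra_simps)
  qed
  then show ?thesis
    using touching_polynomial[OF assms(1) b(2), of p] b assms(4)
    unfolding l_def[symmetric] m_def[symmetric] by (intro bexI[of _ b]) auto
qed

section \<open>Existence of a nonradial arc\<close>

lemma height_derivatives:
  assumes "boltzmann_motion q" "1 < q t $ 2"
  shows "((\<lambda>s. q s $ 2) has_real_derivative momentum q t $ 2) (at t)"
    and "((\<lambda>s. momentum q s $ 2) has_real_derivative - (q t $ 2 / norm (q t) ^ 3)) (at t)"
proof -
  have d: "(q has_vector_derivative momentum q t) (at t)"
    and m: "(momentum q has_vector_derivative - (1 / norm (q t) ^ 3) *\<^sub>R q t) (at t)"
    using assms by (auto simp: boltzmann_motion_def momentum_def vector_derivative_works)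
  show "((\<lambda>s. q s $ 2) has_real_derivative momentum q t $ 2) (at t)"
    unfolding has_real_derivative_iff_has_vector_derivative
    using bounded_linear.has_vector_derivative[OF bounded_linear_vec_nth d, of 2] by simp
  show "((\<lambda>s. momentum q s $ 2) has_real_derivative - (q t $ 2 / norm (q t) ^ 3)) (at t)"
    unfolding has_real_derivative_iff_has_vector_derivative
    using bounded_linear.has_vector_derivative[OF bounded_linear_vec_nth m, of 2] by simp
qed

lemma vertical_momentum_decreasing:
  assumes q: "boltzmann_motion q" and "s < t" and above: "\<And>x. s \<le> x \<Longrightarrow> x \<le> t \<Longrightarrow> 1 < q x $ 2"
  shows "momentum q t $ 2 < momentum q s $ 2"
proof (rule DERIV_neg_imp_decreasing[OF \<open>s < t\<close>])
  fix x
  assume x: "s \<le> x" "x \<le> t"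
  then have "1 < q x $ 2"
    by (rule above)
  then have "q x \<noteq> 0"
    by auto
  then have "- (q x $ 2 / norm (q x) ^ 3) < 0"
    using \<open>1 < q x $ 2\<close> by simp
  then show "\<exists>y. ((\<lambda>s. momentum q s $ 2) has_real_derivative y) (at x) \<and> y < 0"
    using height_derivatives(2)[OF q \<open>1 < q x $ 2\<close>] by blast
qed

text \<open>
  Without an impact the height would be a strictly concave function, bounded below on the whole
  line. Its tangent at a point of nonzero slope c and height f vanishes at time t0 - f/c, and the
  graph lies below the tangent.
\<close>

lemma impact_exists:
  assumes q: "boltzmann_motion q"
  shows "\<exists>t. q t $ 2 = 1"
proof (rule ccontr)
  assume no: "\<nexists>t. q t $ 2 = 1"
  have above: "1 < q t $ 2" for t
    using q no unfolding boltzmann_motion_def by (metis order_le_less)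
  have mvt: "\<exists>\<xi>. s < \<xi> \<and> \<xi> < t \<and> q t $ 2 - q s $ 2 = (t - s) * momentum q \<xi> $ 2" if "s < t" for s t
    using MVT2[OF that, of "\<lambda>x. q x $ 2" "\<lambda>x. momentum q x $ 2"] height_derivatives(1)[OF q above]
    by blast
  have dec: "momentum q t $ 2 < momentum q s $ 2" if "s < t" for s t
    using vertical_momentum_decreasing[OF q that] above by blast
  obtain t0 where t0: "momentum q t0 $ 2 \<noteq> 0"
    using dec[of 0 1] by (metis less_irrefl zero_less_one)
  define c where "c = momentum q t0 $ 2"
  define f where "f = q t0 $ 2"
  have "f > 1"
    using above by (simp add: f_def)
  show False
  proof (cases "c > 0")
    case True
    define t where "t = t0 - f / c"
    have "t < t0"
      using True \<open>f > 1\<close> by (simp add: t_def)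
    then obtain \<xi> where \<xi>: "\<xi> < t0" "f - q t $ 2 = (t0 - t) * momentum q \<xi> $ 2"
      using mvt[of t t0] by (auto simp: f_def)
    have "(t0 - t) * c \<le> (t0 - t) * momentum q \<xi> $ 2"
      using dec[OF \<xi>(1)] \<open>t < t0\<close> by (simp add: c_def)
    moreover have "(t0 - t) * c = f"
      using True by (simp add: t_def)
    ultimately show False
      using \<xi>(2) above[of t] by linarith
  next
    case False
    then have "c < 0"
      using t0 by (simp add: c_def)
    define t where "t = t0 - f / c"
    have "t0 < t"
      using \<open>c < 0\<close> \<open>f > 1\<close> by (simp add: t_def divide_pos_neg)
    then obtain \<xi> where \<xi>: "t0 < \<xi>" "q t $ 2 - f = (t - t0) * momentum q \<xi> $ 2"
      using mvt[of t0 t] by (auto simp: f_def)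
    have "(t - t0) * momentum q \<xi> $ 2 \<le> (t - t0) * c"
      using dec[OF \<xi>(1)] \<open>t0 < t\<close> by (simp add: c_def)
    moreover have "(t - t0) * c = - f"
      using \<open>c < 0\<close> by (simp add: t_def)
    ultimately show False
      using \<xi>(2) above[of t] by linarith
  qed
qed

text \<open>
  A particle starting at rest on the wall would be pulled below it: its vertical momentum would
  decrease from 0, although the height has to increase.
\<close>

lemma impact_momentum_nonzero:
  assumes q: "boltzmann_motion q" and t: "q t $ 2 = 1"
  shows "\<not> (momentum q \<longlongrightarrow> 0) (at_right t)"
proof
  assume lim: "(momentum q \<longlongrightarrow> 0) (at_right t)"
  have "\<forall>\<^sub>F s in at_right t. 1 < q s $ 2"
    using q t unfolding boltzmann_motion_def by (metis eventually_at_split)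
  then obtain u where u: "u > t" "\<And>s. t < s \<Longrightarrow> s < u \<Longrightarrow> 1 < q s $ 2"
    unfolding eventually_at_right_field by blast
  define s where "s = (t + u) / 2"
  have s: "t < s" "s < u"
    using u(1) by (simp_all add: s_def)
  have "continuous_on {t..s} (\<lambda>x. q x $ 2)"
    using q unfolding boltzmann_motion_def
    by (intro continuous_intros) (auto intro: continuous_on_subset)
  moreover have "((\<lambda>x. q x $ 2) has_derivative (\<lambda>h. h * momentum q x $ 2)) (at x)" if "t < x" "x < s" for x
    using height_derivatives(1)[OF q u(2)[of x]] that s
    by (simp add: has_field_derivative_def mult.commute[of _ "momentum q x $ 2"])
  ultimately obtain \<xi> where \<xi>: "t < \<xi>" "\<xi> < s" "q s $ 2 - q t $ 2 = (s - t) * momentum q \<xi> $ 2"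
    using mvt[OF s(1), of "\<lambda>x. q x $ 2" "\<lambda>x h. h * momentum q x $ 2"] by blast
  have "(s - t) * momentum q \<xi> $ 2 > 0"
    using \<xi>(3) u(2)[of s] s t by simp
  then have pos: "momentum q \<xi> $ 2 > 0"
    using s by (simp add: zero_less_mult_iff)
  have "momentum q \<xi> $ 2 \<le> momentum q x $ 2" if "t < x" "x < \<xi>" for x
    using vertical_momentum_decreasing[OF q that(2)] u(2) that \<xi> s by (simp add: less_imp_le)
  then have "\<forall>\<^sub>F x in at_right t. momentum q \<xi> $ 2 \<le> momentum q x $ 2"
    unfolding eventually_at_right_field using \<xi>(1) by blast
  moreover have "((\<lambda>x. momentum q x $ 2) \<longlongrightarrow> 0) (at_right t)"
    using tendsto_vec_nth[OF lim, of 2] by simp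
  ultimately have "momentum q \<xi> $ 2 \<le> 0"
    using tendsto_lowerbound trivial_limit_at_right_real by blast
  then show False
    using pos by simp
qed

text \<open>
  Suppose that all states are radial. At an impact point (x, 1), the angular momentum has limit 0 on
  both sides, so x v2 - v1 = 0 before and - x v2 - v1 = 0 after the reflection. For radial states D is
  2 r2/|r|, so x = 0 would force D = 2, which is excluded. Hence x is nonzero and v = 0, which is impossible at an impact.
\<close>

lemma nonradial_state_exists:
  assumes "q \<in> level_set D E" "D\<^sup>2 \<noteq> 4"
  shows "\<exists>t. 1 < q t $ 2 \<and> angular_momentum (q t) (momentum q t) \<noteq> 0"
proof (rule ccontr)
  assume "\<not> ?thesis"
  then have radial: "angular_momentum (q t) (momentum q t) = 0" if "1 < q t $ 2" for t
    using that by blast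
  have q: "boltzmann_motion q"
    and D: "\<And>t. 1 < q t $ 2 \<Longrightarrow> D_integral (q t) (momentum q t) = D"
    using assms(1) by (auto simp: level_set_def)
  obtain t where t: "q t $ 2 = 1"
    using impact_exists[OF q] by blast
  obtain v where vl: "(momentum q \<longlongrightarrow> v) (at_left t)"
    and vr: "(momentum q \<longlongrightarrow> vector [v$1, - (v$2)]) (at_right t)"
    and ev: "\<forall>\<^sub>F s in at t. 1 < q s $ 2"
    using q t unfolding boltzmann_motion_def by metis
  then have evl: "\<forall>\<^sub>F s in at_left t. 1 < q s $ 2" and evr: "\<forall>\<^sub>F s in at_right t. 1 < q s $ 2"
    by (auto simp: eventually_at_split)
  have "isCont q t"
    using q by (simp add: boltzmann_motion_def continuous_on_eq_continuous_at)
  then have ql: "(q \<longlongrightarrow> q t) (at_left t)" and qr: "(q \<longlongrightarrow> q t) (at_right t)"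
    by (auto simp: isCont_def filterlim_at_split)
  have Llim: "angular_momentum (q t) w = 0"
    if "(q \<longlongrightarrow> q t) F" "(momentum q \<longlongrightarrow> w) F" "\<forall>\<^sub>F s in F. 1 < q s $ 2" "F \<noteq> bot" for F w
  proof -
    have "((\<lambda>s. angular_momentum (q s) (momentum q s)) \<longlongrightarrow> angular_momentum (q t) w) F"
      unfolding angular_momentum_def by (intro tendsto_intros that)
    moreover have "((\<lambda>s. angular_momentum (q s) (momentum q s)) \<longlongrightarrow> 0) F"
      by (rule tendsto_eventually) (use that(3) radial in \<open>auto elim: eventually_mono\<close>)
    ultimately show ?thesis
      using tendsto_unique that(4) by blast
  qed
  have L1: "q t $ 1 * v$2 - v$1 = 0"
    using Llim[OF ql vl evl] t by (simp add: angular_momentum_def)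
  have L2: "- (q t $ 1 * v$2) - v$1 = 0"
    using Llim[OF qr vr evr] t by (simp add: angular_momentum_def)
  have "q t \<noteq> 0"
    using t by auto
  have "((\<lambda>s. 2 * q s $ 2 / norm (q s)) \<longlongrightarrow> 2 * q t $ 2 / norm (q t)) (at_left t)"
    by (intro tendsto_intros ql) (use \<open>q t \<noteq> 0\<close> in simp)
  moreover have "\<forall>\<^sub>F s in at_left t. 2 * q s $ 2 / norm (q s) = D"
    using evl by (rule eventually_mono) (use D radial in \<open>simp add: D_integral_def LRL_def\<close>)
  then have "((\<lambda>s. 2 * q s $ 2 / norm (q s)) \<longlongrightarrow> D) (at_left t)"
    by (rule tendsto_eventually)
  ultimately have Dt: "D = 2 / norm (q t)"
    using tendsto_unique[of "at_left t"] t by fastforce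
  have "q t $ 1 \<noteq> 0"
  proof
    assume "q t $ 1 = 0"
    then have "norm (q t) = 1"
      using t by (simp add: norm_vec_def L2_set_def sum_2)
    then show False
      using Dt assms(2) by simp
  qed
  then have "v$1 = 0" "v$2 = 0"
    using L1 L2 by auto
  then have "vector [v$1, - (v$2)] = (0 :: real^2)"
    by (simp add: vec_eq_iff forall_2)
  then show False
    using impact_momentum_nonzero[OF q t] vr by simp
qed

section \<open>The two conics touched by all arcs\<close>

theorem theorem3p2:
  fixes E D :: real
  assumes "E \<noteq> 0"
    and "D\<^sup>2 \<noteq> 4"
    and "1 + 2 * E * D + 4 * E\<^sup>2 \<noteq> 0"
    and "D + 2 * E \<noteq> 0"
    and "level_set D E \<noteq> {}"
  shows "E_plus D E \<noteq> E_minus D E \<and>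
    {C. conic_with_foci 0 (vector [0, 2]) C \<and>
        (\<forall>q \<in> level_set D E. \<forall>I \<in> arcs q. arc_touches q I C)}
    = {E_plus D E, E_minus D E}"
proof -
  define R where "R = R_const D E"
  \<comment> \<open>The signed semi-axes: a2 is negative when E is positive, opposite to the number in the equation
    of E_plus.\<close>
  define a1 where "a1 = (R - 1) / (2 * E)"
  define a2 where "a2 = - ((R + 1) / (2 * E))"
  obtain q0 where q0: "q0 \<in> level_set D E"
    using assms(5) by blast
  obtain t0 where t0: "1 < q0 t0 $ 2" "angular_momentum (q0 t0) (momentum q0 t0) \<noteq> 0"
    using nonradial_state_exists[OF q0 assms(2)] by blast
  \<comment> \<open>The origin is below the wall, so the position never vanishes.\<close>
  have int: "energy (q t) (momentum q t) = E" "D_integral (q t) (momentum q t) = D" "q t \<noteq> 0"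
    if "q \<in> level_set D E" "1 < q t $ 2" for q t
    using that by (auto simp: level_set_def)
  have "1 + 2 * D * E + 4 * E\<^sup>2 \<ge> 0"
    using LRL_circle[OF int(3)[OF q0 t0(1)], of "momentum q0 t0"] int(1,2)[OF q0 t0(1)]
    by (metis sum_power2_ge_zero)
  then have R: "R\<^sup>2 = 1 + 2 * D * E + 4 * E\<^sup>2" "R > 0"
    using assms(3) by (simp_all add: R_def R_const_def algebra_simps)
  have root: "2 * E * a\<^sup>2 + 2 * a - 2 * E - D = 0 \<longleftrightarrow> a = a1 \<or> a = a2" for a
  proof -
    have "2 * E * a\<^sup>2 + 2 * a - 2 * E - D = 0 \<longleftrightarrow> 2 * E * (2 * E * a\<^sup>2 + 2 * a - 2 * E - D) = 0"
      using assms(1) by simp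
    also have "2 * E * (2 * E * a\<^sup>2 + 2 * a - 2 * E - D) = (2 * E * a + 1)\<^sup>2 - R\<^sup>2"
      unfolding R(1) by (simp add: power2_eq_square algebra_simps)
    also have "\<dots> = 0 \<longleftrightarrow> 2 * E * a + 1 = R \<or> 2 * E * a + 1 = - R"
      by (simp add: power2_eq_iff)
    also have "\<dots> \<longleftrightarrow> a = a1 \<or> a = a2"
      using assms(1) by (auto simp: a1_def a2_def field_simps)
    finally show ?thesis .
  qed
  have nondeg: "a \<noteq> 0" "a\<^sup>2 \<noteq> 1" if "a = a1 \<or> a = a2" for a
  proof -
    have r: "2 * E * a\<^sup>2 + 2 * a - 2 * E - D = 0"
      using that root by blast
    then show "a \<noteq> 0"
      using assms(4) by auto
    show "a\<^sup>2 \<noteq> 1"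
    proof
      assume "a\<^sup>2 = 1"
      then have "D = 2 * a"
        using r by simp
      then show False
        using assms(2) \<open>a\<^sup>2 = 1\<close> by (simp add: power_mult_distrib)
    qed
  qed
  have Em: "E_minus D E = central_conic a1"
    by (simp add: E_minus_def central_conic_def a1_def R_def)
  have Ep: "E_plus D E = central_conic a2"
    by (simp add: E_plus_def central_conic_def a2_def R_def)
  have "a1\<^sup>2 \<noteq> a2\<^sup>2"
    using R(2) assms(1) by (auto simp: a1_def a2_def power2_eq_iff field_simps)
  then have ne: "E_plus D E \<noteq> E_minus D E"
    using central_conic_cong_square[of a1 a2] nondeg unfolding Em Ep by metis
  have foci: "conic_with_foci 0 (vector [0, 2]) (central_conic a)" if "a = a1 \<or> a = a2" for a
  proof -
    have "\<bar>a\<bar> > 0" "\<bar>a\<bar> \<noteq> 1" "central_conic a = central_conic \<bar>a\<bar>"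
      using nondeg[OF that] by (auto simp: abs_if central_conic_uminus)
    then show ?thesis
      unfolding conic_with_foci_iff_central by blast
  qed
  have touches: "arc_touches q I (central_conic a)"
    if "a = a1 \<or> a = a2" "q \<in> level_set D E" "I \<in> arcs q" for a q I
    unfolding arc_touches_def
  proof (intro exI conjI ballI)
    show "conic_equation (focal_conic (confocal_covector a)) (central_conic a)"
      using nondeg[OF that(1)] by (rule conic_equation_central_conic)
    fix t
    assume "t \<in> I"
    then have "1 < q t $ 2"
      using that(3) in_components_subset unfolding arcs_def by blast
    then show "tangent_conics (kepler_conic (q t) (momentum q t)) (focal_conic (confocal_covector a))"
      using int[OF that(2)] nondeg[OF that(1)] root[of a] that(1)
      by (intro kepler_conic_touches_confocal) auto
  qed
  have only: "C = central_conic a1 \<or> C = central_conic a2"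
    if foci: "conic_with_foci 0 (vector [0, 2]) C"
      and touch: "\<forall>q \<in> level_set D E. \<forall>I \<in> arcs q. arc_touches q I C" for C
  proof -
    obtain a where a: "a > 0" "a \<noteq> 1" "C = central_conic a"
      using foci conic_with_foci_iff_central by blast
    have a': "a \<noteq> 0" "a\<^sup>2 \<noteq> 1"
      using a by (auto simp: power2_eq_1_iff)
    obtain I where I: "I \<in> arcs q0" "t0 \<in> I"
      using t0(1) unfolding arcs_def by (metis UnionE Union_components mem_Collect_eq)
    then obtain N where N: "conic_equation N C"
      "tangent_conics (kepler_conic (q0 t0) (momentum q0 t0)) N"
      using touch q0 unfolding arc_touches_def by blast
    obtain c where "c \<noteq> 0" "N = c *\<^sub>R focal_conic (confocal_covector a)"
      using central_conic_equation_unique[OF a'] N(1) a(3) by blast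
    then have "tangent_conics (kepler_conic (q0 t0) (momentum q0 t0))
        (focal_conic (confocal_covector a))"
      using N(2) tangent_conics_scaleR_right by blast
    then obtain b where b: "b \<in> {a, - a}" "2 * E * b\<^sup>2 + 2 * b - 2 * E - D = 0"
      using confocal_touching_root[OF int(3)[OF q0 t0(1)] a' t0(2)] unfolding int(1,2)[OF q0 t0(1)]
      by blast
    have "C = central_conic b"
      using b(1) a(3) central_conic_uminus by auto
    then show ?thesis
      using b(2) root[of b] by blast
  qed
  have "(conic_with_foci 0 (vector [0, 2]) C \<and>
        (\<forall>q \<in> level_set D E. \<forall>I \<in> arcs q. arc_touches q I C))
      \<longleftrightarrow> C = central_conic a1 \<or> C = central_conic a2" for C
    using foci touches only by metis
  then show ?thesis
    using ne unfolding Em Ep by (simp add: insert_commute set_eq_iff del: Collect_conj_eq)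
qed

end
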